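(* Let $X$ be a real normed space and $K\subset X$ a closed convex pointed cone. Let $A,B,C\subset X$ be nonempty sets such that $C$ is weakly $K$-compact and $\operatorname{cl}B$ is $K$-convex. Then $$e(A,B+K)=e(A+C,B+K+C).$$
   Context: Sums of sets are Minkowski sums; $\operatorname{cl}$ is the norm closure. A cone $K$ is pointed if $K\cap(-K)=\{0\}$. For nonempty $A,B\subset X$, the excess from $A$ to $B$ is $e(A,B)=\sup_{x\in A}d(x,B)\in[0,+\infty]$, where $d(x,B)=\inf_{b\in B}\|x-b\|$. A nonempty set $S\subset X$ is $K$-convex if $S+K$ is convex. A nonempty set $C\subset X$ is weakly $K$-compact if from every cover of $C$ by sets of the form $U+K$, with $U\subset X$ weakly open, one can extract a finite subcover. *)

theory Defs
  imports "HOL-Analysis.Analysis" "HOL-Library.Set_Algebras"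
begin

text \<open>
  The sum \<open>A + B\<close> of two sets is the Minkowski sum of \<open>Set_Algebras\<close>. On sets, \<open>- K\<close> is the
  complement, so the reflected cone is written \<open>uminus ` K\<close>.
\<close>

definition pointed :: "'a::real_vector set \<Rightarrow> bool"
  where "pointed K \<longleftrightarrow> K \<inter> uminus ` K = {0}"

text \<open>
  For nonempty \<open>B\<close>, \<open>infdist x B\<close> is the infimum of the distances \<open>dist x b\<close>, \<open>b \<in> B\<close>. The supremum
  is taken in \<^typ>\<open>ennreal\<close>, so it may be infinite. The definition is only meaningful for
  nonempty sets (\<open>infdist\<close> to the empty set is \<open>0\<close>).
\<close>

definition excess :: "'a::metric_space set \<Rightarrow> 'a set \<Rightarrow> ennreal"
  where "excess A B = (SUP x\<in>A. ennreal (infdist x B))"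

definition K_convex :: "'a::real_vector set \<Rightarrow> 'a set \<Rightarrow> bool"
  where "K_convex K S \<longleftrightarrow> S \<noteq> {} \<and> convex (S + K)"

text \<open>The coarsest topology making all norm-continuous linear functionals continuous.\<close>

definition weak_topology :: "'a::real_normed_vector topology"
  where "weak_topology =
    topology_generated_by {f -` V | (f :: 'a \<Rightarrow> real) V. bounded_linear f \<and> open V}"

definition weakly_K_compact :: "'a::real_normed_vector set \<Rightarrow> 'a set \<Rightarrow> bool"
  where "weakly_K_compact K C \<longleftrightarrow> C \<noteq> {} \<and>
    (\<forall>\<G>. (\<forall>G\<in>\<G>. \<exists>U. openin weak_topology U \<and> G = U + K) \<and> C \<subseteq> \<Union>\<G>
      \<longrightarrow> (\<exists>\<F>\<subseteq>\<G>. finite \<F> \<and> C \<subseteq> \<Union>\<F>))"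

end

theory Submission
  imports Defs
begin

text \<open>
  Let \<open>\<delta>\<close> be the distance from \<open>a\<close> to \<open>B + K\<close>. By Hahn--Banach there is a functional \<open>f\<close> of norm at
  most \<open>1\<close> with \<open>f \<ge> f a + \<delta>\<close> on \<open>B + K\<close>. It is nonnegative on the cone \<open>K\<close>, so the sets \<open>{f > -n} + K\<close>
  cover \<open>C\<close> and weak \<open>K\<close>-compactness makes \<open>f\<close> bounded below on \<open>C\<close>. If \<open>c \<in> C\<close> nearly minimizes \<open>f\<close> on
  \<open>C\<close>, then \<open>f\<close> shows that \<open>a + c\<close> has distance almost \<open>\<delta>\<close> from \<open>B + K + C\<close>. The Hahn--Banach theorem
  is obtained from Zorn's lemma: a minimal sublinear functional is linear.
\<close>

section \<open>Sublinear functionals\<close>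

definition sublinear :: "('a::real_vector \<Rightarrow> real) \<Rightarrow> bool"
  where "sublinear q \<longleftrightarrow>
    (\<forall>x y. q (x + y) \<le> q x + q y) \<and> (\<forall>c\<ge>0. \<forall>x. q (c *\<^sub>R x) = c * q x)"

text \<open>Only the upper half of homogeneity has to be checked: using it for the vector
  \<open>c *\<^sub>R x\<close> and the factor \<open>inverse c\<close> yields the other half. This
  suits the functionals below, which are defined as infima.\<close>

lemma sublinearI:
  assumes add: "\<And>x y. q (x + y) \<le> q x + q y"
    and zero: "q 0 = 0"
    and scale: "\<And>c x. c > 0 \<Longrightarrow> q (c *\<^sub>R x) \<le> c * q x"
  shows "sublinear q"
proof -
  have "q (c *\<^sub>R x) = c * q x" if "c > 0" for c x
  proof -
    have "q (inverse c *\<^sub>R (c *\<^sub>R x)) \<le> inverse c * q (c *\<^sub>R x)"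
      using that by (intro scale) simp
    then have "c * q x \<le> q (c *\<^sub>R x)"
      using that by (simp add: field_simps)
    with scale[OF that, of x] show ?thesis by simp
  qed
  then show ?thesis
    unfolding sublinear_def using add zero by (metis less_eq_real_def mult_zero_left scaleR_zero_left)
qed

lemma sublinear_add: "sublinear q \<Longrightarrow> q (x + y) \<le> q x + q y"
  by (simp add: sublinear_def)

lemma sublinear_scaleR: "sublinear q \<Longrightarrow> c \<ge> 0 \<Longrightarrow> q (c *\<^sub>R x) = c * q x"
  by (simp add: sublinear_def)

lemma sublinear_zero: "sublinear q \<Longrightarrow> q 0 = 0"
  using sublinear_scaleR[of q 0 0] by simp

lemma sublinear_minus: "sublinear q \<Longrightarrow> - q (- x) \<le> q x"
  using sublinear_add[of q x "- x"] sublinear_zero[of q] by simp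

lemma sublinear_norm: "sublinear norm"
  by (simp add: sublinear_def norm_triangle_ineq)

text \<open>Each pair \<open>(v, s)\<close> of \<open>P\<close> is a constraint on the values of a
  functional below \<open>q\<close>, and \<open>r\<close> is the infimum of all
  \<open>q (x + v) - s\<close>. The bound \<open>s \<le> q v\<close> keeps the infimum finite;
  closure of \<open>P\<close> under sums and scaling makes \<open>r\<close> sublinear. Used with a
  ray to linearize minimal functionals, and with the cone over a convex set to separate.\<close>

lemma sublinear_inf_cone:
  fixes q :: "'a::real_vector \<Rightarrow> real" and P :: "('a \<times> real) set"
  assumes q: "sublinear q" and P: "convex_cone P"
    and below: "\<And>v s. (v, s) \<in> P \<Longrightarrow> s \<le> q v"
  obtains r where "sublinear r" "r \<le> q" "\<And>v s. (v, s) \<in> P \<Longrightarrow> r (- v) \<le> - s"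
proof -
  define r where "r x = (INF p\<in>P. q (x + fst p) - snd p)" for x
  have P0: "(0, 0) \<in> P"
    using convex_cone_contains_0[OF P] by (simp add: zero_prod_def)
  \<comment> \<open>Comes from \<open>s \<le> q v \<le> q (x + v) + q (- x)\<close>; the bound is
    the same for every pair in \<open>P\<close>.\<close>
  have lower: "- q (- x) \<le> q (x + fst p) - snd p" if "p \<in> P" for x p
    using sublinear_add[OF q, of "x + fst p" "- x"] below[of "fst p" "snd p"] that by simp
  have bdd: "bdd_below ((\<lambda>p. q (x + fst p) - snd p) ` P)" for x
    using lower by (intro bdd_belowI2)
  have r_le: "r x \<le> q (x + v) - s" if "(v, s) \<in> P" for x v s
    unfolding r_def using cINF_lower[OF bdd that] by simp
  have r_ge: "m \<le> r x" if "\<And>v s. (v, s) \<in> P \<Longrightarrow> m \<le> q (x + v) - s" for m x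
    unfolding r_def using P0 that by (intro cINF_greatest) auto
  have "sublinear r"
  proof (rule sublinearI)
    fix x y
    \<comment> \<open>One term stands on the left so that the infima defining \<open>r x\<close> and
      \<open>r y\<close> can be taken one after the other.\<close>
    have step: "r (x + y) - (q (y + w) - t) \<le> q (x + v) - s"
      if "(v, s) \<in> P" "(w, t) \<in> P" for v s w t
    proof -
      have "(v + w, s + t) \<in> P"
        using convex_cone_add[OF P that] by simp
      then have "r (x + y) \<le> q ((x + v) + (y + w)) - (s + t)"
        using r_le[of "v + w" "s + t" "x + y"] by (simp add: algebra_simps)
      then show ?thesis
        using sublinear_add[OF q, of "x + v" "y + w"] by simp
    qed
    have "r (x + y) - r x \<le> q (y + w) - t" if "(w, t) \<in> P" for w t
      using r_ge[of "r (x + y) - (q (y + w) - t)" x] step that by fastforce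
    then show "r (x + y) \<le> r x + r y"
      using r_ge[of "r (x + y) - r x" y] by fastforce
  next
    show "r 0 = 0"
      using r_le[OF P0, of 0] r_ge[of 0 0] below sublinear_zero[OF q] by force
  next
    fix c :: real and x assume c: "c > 0"
    have "r (c *\<^sub>R x) / c \<le> q (x + v) - s" if "(v, s) \<in> P" for v s
    proof -
      have "(c *\<^sub>R v, c * s) \<in> P"
        using convex_cone_scaleR[OF P _ that, of c] c by simp
      then have "r (c *\<^sub>R x) \<le> q (c *\<^sub>R (x + v)) - c * s"
        using r_le by (simp add: scaleR_add_right)
      then show ?thesis
        using c sublinear_scaleR[OF q, of c "x + v"] by (simp add: field_simps)
    qed
    then show "r (c *\<^sub>R x) \<le> c * r x"
      using r_ge[of "r (c *\<^sub>R x) / c" x] c by (simp add: field_simps)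
  qed
  moreover have "r \<le> q"
    using r_le[OF P0] by (simp add: le_fun_def)
  moreover have "r (- v) \<le> - s" if "(v, s) \<in> P" for v s
    using r_le[OF that, of "- v"] sublinear_zero[OF q] by simp
  ultimately show thesis
    using that by blast
qed

text \<open>Provides the bounds of chains for Zorn's lemma by a pointwise infimum, which is finite
  because \<open>- p (- x) \<le> r x\<close> for every member \<open>r\<close>.\<close>

lemma sublinear_INF_chain:
  fixes R :: "('a::real_vector \<Rightarrow> real) set"
  assumes "R \<noteq> {}" and sub: "\<And>r. r \<in> R \<Longrightarrow> sublinear r" "\<And>r. r \<in> R \<Longrightarrow> r \<le> p"
    and chain: "\<And>r s. r \<in> R \<Longrightarrow> s \<in> R \<Longrightarrow> r \<le> s \<or> s \<le> r"
  obtains q where "sublinear q" "\<And>r. r \<in> R \<Longrightarrow> q \<le> r"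
proof -
  define q where "q x = (INF r\<in>R. r x)" for x
  have "- p (- x) \<le> r x" if "r \<in> R" for x r
    using sublinear_minus[OF sub(1)[OF that], of x] sub(2)[OF that]
    by (smt (verit) le_funD)
  then have bdd: "bdd_below ((\<lambda>r. r x) ` R)" for x
    by (intro bdd_belowI2)
  have q_le: "q x \<le> r x" if "r \<in> R" for r x
    unfolding q_def using cINF_lower[OF bdd that] .
  have q_ge: "m \<le> q x" if "\<And>r. r \<in> R \<Longrightarrow> m \<le> r x" for m x
    unfolding q_def using \<open>R \<noteq> {}\<close> that by (intro cINF_greatest)
  have "sublinear q"
  proof (rule sublinearI)
    fix x y
    have step: "q (x + y) - s y \<le> r x" if rs: "r \<in> R" "s \<in> R" for r s
    proof -
      \<comment> \<open>The smaller of \<open>r\<close> and \<open>s\<close> serves at both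
        \<open>x\<close> and \<open>y\<close>, so the subadditivity of a single functional is
        enough.\<close>
      obtain t where t: "t \<in> R" "t \<le> r" "t \<le> s"
        using chain[OF rs] rs by blast
      have "q (x + y) \<le> t x + t y"
        using q_le[OF t(1), of "x + y"] sublinear_add[OF sub(1)[OF t(1)], of x y] by simp
      then show ?thesis
        using le_funD[OF t(2), of x] le_funD[OF t(3), of y] by simp
    qed
    have "q (x + y) - q x \<le> s y" if "s \<in> R" for s
      using q_ge[of "q (x + y) - s y" x] step that by fastforce
    then show "q (x + y) \<le> q x + q y"
      using q_ge[of "q (x + y) - q x" y] by fastforce
  next
    show "q 0 = 0"
      using \<open>R \<noteq> {}\<close> q_le[of _ 0] q_ge[of 0 0] sublinear_zero[OF sub(1)] by force
  next
    fix c :: real and x assume c: "c > 0"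
    have "q (c *\<^sub>R x) / c \<le> r x" if "r \<in> R" for r
      using q_le[OF that, of "c *\<^sub>R x"] sublinear_scaleR[OF sub(1)[OF that], of c x] c
      by (simp add: field_simps)
    then show "q (c *\<^sub>R x) \<le> c * q x"
      using q_ge[of "q (c *\<^sub>R x) / c" x] c by (simp add: field_simps)
  qed
  then show thesis
    using that q_le by (simp add: le_fun_def)
qed

section \<open>Minimal sublinear functionals and the Hahn-Banach theorem\<close>

text \<open>The ray through \<open>(y, q y)\<close> gives a sublinear \<open>r \<le> q\<close> with
  \<open>r (- y) \<le> - q y\<close>. Minimality forces \<open>r = q\<close>, so
  \<open>q (- y) \<le> - q y\<close>, and subadditivity at \<open>x + y\<close> and
  \<open>- y\<close> turns this into superadditivity.\<close>

lemma minimal_sublinear_linear: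
  assumes q: "sublinear q" and min: "\<And>r. sublinear r \<Longrightarrow> r \<le> q \<Longrightarrow> r = q"
  shows "linear q"
proof -
  have super: "q x + q y \<le> q (x + y)" for x y
  proof -
    define P where "P = (\<lambda>t. t *\<^sub>R (y, q y)) ` {0..}"
    have "convex_cone P"
      unfolding convex_cone_iff
    proof (intro conjI ballI allI impI)
      show "0 \<in> P"
        unfolding P_def by (rule image_eqI[of _ _ 0]) (auto simp: zero_prod_def)
    next
      fix u v assume "u \<in> P" "v \<in> P"
      then obtain s t where "s \<ge> 0" "t \<ge> 0" "u = s *\<^sub>R (y, q y)" "v = t *\<^sub>R (y, q y)"
        unfolding P_def by auto
      then show "u + v \<in> P"
        unfolding P_def by (intro image_eqI[of _ _ "s + t"]) (auto simp: algebra_simps)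
    next
      fix u and c :: real assume "u \<in> P" "c \<ge> 0"
      then obtain t where "t \<ge> 0" "u = t *\<^sub>R (y, q y)"
        unfolding P_def by auto
      then show "c *\<^sub>R u \<in> P"
        unfolding P_def using \<open>c \<ge> 0\<close> by (intro image_eqI[of _ _ "c * t"]) auto
    qed
    moreover have "s \<le> q v" if "(v, s) \<in> P" for v s
      using that sublinear_scaleR[OF q] by (auto simp: P_def)
    ultimately obtain r where r: "sublinear r" "r \<le> q" "\<And>v s. (v, s) \<in> P \<Longrightarrow> r (- v) \<le> - s"
      using sublinear_inf_cone[OF q] by blast
    have "(y, q y) \<in> P"
      unfolding P_def by (rule image_eqI[of _ _ 1]) auto
    then have "q (- y) \<le> - q y"
      using r min by metis
    then show ?thesis
      using sublinear_add[OF q, of "x + y" "- y"] by simp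
  qed
  have add: "q (x + y) = q x + q y" for x y
    using super[of x y] sublinear_add[OF q, of x y] by simp
  have neg: "q (- x) = - q x" for x
    using add[of x "- x"] sublinear_zero[OF q] by simp
  have "q (c *\<^sub>R x) = c * q x" for c x
  proof (cases "c \<ge> 0")
    case True
    then show ?thesis by (rule sublinear_scaleR[OF q])
  next
    case False
    then have "q ((- c) *\<^sub>R x) = - c * q x"
      by (intro sublinear_scaleR[OF q]) simp
    then show ?thesis
      using neg[of "c *\<^sub>R x"] by simp
  qed
  then show ?thesis
    using add by (intro linearI) auto
qed

theorem hahn_banach_sublinear:
  fixes p :: "'a::real_vector \<Rightarrow> real"
  assumes p: "sublinear p"
  obtains f where "linear f" "f \<le> p"
proof -
  define S where "S = {q. sublinear q \<and> q \<le> p}"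
  have "\<exists>m\<in>S. \<forall>r\<in>S. r \<le> m \<longrightarrow> r = m"
  \<comment> \<open>The order is reversed: a maximal element for Zorn's lemma is a minimal
    functional.\<close>
  proof (rule predicate_Zorn)
    show "partial_order_on S (relation_of (\<lambda>q r. r \<le> q) S)"
      by (rule partial_order_on_relation_ofI) auto
  next
    fix R assume R: "R \<in> Chains (relation_of (\<lambda>q r. r \<le> q) S)"
    then have RS: "R \<subseteq> S" and chain: "r \<le> s \<or> s \<le> r" if "r \<in> R" "s \<in> R" for r s
      using that unfolding Chains_def relation_of_def by auto
    show "\<exists>u\<in>S. \<forall>r\<in>R. u \<le> r"
    proof (cases "R = {}")
      case True
      then show ?thesis using p by (auto simp: S_def)
    next
      case False
      then obtain r where r: "r \<in> R" by blast
      have "R \<subseteq> S" using RS[OF r r] .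
      then obtain q where q: "sublinear q" "\<And>r. r \<in> R \<Longrightarrow> q \<le> r"
        using sublinear_INF_chain[OF False, of p] chain by (auto simp: S_def subset_iff)
      moreover have "q \<le> p"
        using q(2)[OF r] \<open>R \<subseteq> S\<close> r by (auto simp: S_def)
      ultimately show ?thesis by (auto simp: S_def)
    qed
  qed
  then obtain f where f: "sublinear f" "f \<le> p" "\<And>r. sublinear r \<Longrightarrow> r \<le> p \<Longrightarrow> r \<le> f \<Longrightarrow> r = f"
    unfolding S_def by blast
  then have "linear f"
    using order_trans by (intro minimal_sublinear_linear) blast+
  with f that show thesis by blast
qed

section \<open>Separation of a point from a convex set\<close>

text \<open>The pairs \<open>(t *\<^sub>R (x - a), t * \<delta>)\<close> with
  \<open>x \<in> S\<close> and \<open>t \<ge> 0\<close> form a convex cone \<open>P\<close>, and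
  \<open>\<delta> \<le> dist a x\<close> says that it lies on or below the graph of the norm. So the
  norm can be lowered to a sublinear \<open>p\<close> with \<open>p (a - x) \<le> - \<delta>\<close>
  on \<open>S\<close>, and every linear \<open>f \<le> p\<close> separates.\<close>

lemma convex_separate_point:
  fixes S :: "'a::real_normed_vector set"
  assumes S: "convex S" "S \<noteq> {}" and "\<delta> \<ge> 0" and dist: "\<And>x. x \<in> S \<Longrightarrow> \<delta> \<le> dist a x"
  obtains f :: "'a \<Rightarrow> real"
  where "bounded_linear f" "\<And>x. f x \<le> norm x" "\<And>x. x \<in> S \<Longrightarrow> f a + \<delta> \<le> f x"
proof -
  define T where "T = (\<lambda>x. (x - a, \<delta>)) ` S"
  define P where "P = cone hull T"
  \<comment> \<open>Exhibits \<open>T\<close> as a translate of a linear image of \<open>S\<close>,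
    hence convex.\<close>
  have "T = (\<lambda>v. (- a, \<delta>) + v) ` (\<lambda>x. (x, 0)) ` S"
    unfolding T_def by (simp add: image_image)
  moreover have "convex ((\<lambda>x. (x, 0::real)) ` S)"
    by (intro convex_linear_image S linearI) auto
  ultimately have "convex T"
    by (simp only: convex_translation)
  then have "convex P"
    unfolding P_def by (rule convex_cone_hull)
  moreover have "cone P" "0 \<in> P"
    unfolding P_def using S(2) by (auto simp: cone_cone_hull T_def simp flip: cone_hull_contains_0)
  ultimately have "convex_cone P"
    unfolding convex_cone_iff using convex_cone[of P] by blast
  moreover have "s \<le> norm v" if vs: "(v, s) \<in> P" for v s
  proof -
    obtain t x where "t \<ge> 0" "x \<in> S" "v = t *\<^sub>R (x - a)" "s = t * \<delta>"
      using vs unfolding P_def T_def cone_hull_expl by auto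
    then show ?thesis
      using dist[of x] by (simp add: dist_norm norm_minus_commute mult_left_mono)
  qed
  ultimately obtain p where p: "sublinear p" "p \<le> norm" "\<And>v s. (v, s) \<in> P \<Longrightarrow> p (- v) \<le> - s"
    using sublinear_inf_cone[OF sublinear_norm] by blast
  obtain f where f: "linear f" "f \<le> p"
    using hahn_banach_sublinear[OF p(1)] .
  have f_norm: "f x \<le> norm x" for x
    using le_funD[OF f(2), of x] le_funD[OF p(2), of x] by simp
  \<comment> \<open>The one-sided bound at \<open>x\<close> and at \<open>- x\<close> controls the
    absolute value.\<close>
  have "norm (f x) \<le> norm x * 1" for x
    using f_norm[of x] f_norm[of "- x"] linear_neg[OF f(1), of x] by simp
  then have "bounded_linear f"
    using linear_add[OF f(1)] linear_scale[OF f(1)] by (intro bounded_linear_intro[of f 1])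
  moreover have "f a + \<delta> \<le> f x" if "x \<in> S" for x
  proof -
    have "(x - a, \<delta>) \<in> P"
      unfolding P_def T_def using that by (intro hull_inc) simp
    then have "f (- (x - a)) \<le> - \<delta>"
      using p(3) le_funD[OF f(2)] by (meson order_trans)
    then show ?thesis
      using linear_diff[OF f(1), of a x] by simp
  qed
  ultimately show thesis
    using that f_norm by blast
qed

section \<open>Excess and cancellation\<close>

text \<open>Adding elements of \<open>K\<close> cannot lower \<open>f\<close>, so
  \<open>f > - n\<close> on all of \<open>G n\<close>; the largest index of a finite subcover gives
  the bound.\<close>

lemma weakly_K_compact_bdd_below:
  fixes f :: "'a::real_normed_vector \<Rightarrow> real"
  assumes C: "weakly_K_compact K C" and f: "bounded_linear f"
    and "0 \<in> K" and nonneg: "\<And>k. k \<in> K \<Longrightarrow> 0 \<le> f k"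
  shows "bdd_below (f ` C)"
proof -
  define G where "G n = f -` {- real n<..} + K" for n
  have "openin weak_topology (f -` {- real n<..})" for n
    unfolding weak_topology_def openin_topology_generated_by_iff
    using f by (intro generate_topology_on.Basis CollectI exI[of _ f] exI[of _ "{- real n<..}"]) auto
  then have "\<forall>g\<in>range G. \<exists>U. openin weak_topology U \<and> g = U + K"
    unfolding G_def by blast
  moreover have "C \<subseteq> \<Union>(range G)"
  proof
    fix c
    obtain n where "- f c < real n"
      using reals_Archimedean2 by blast
    then have "c + 0 \<in> G n"
      unfolding G_def using \<open>0 \<in> K\<close> by (intro set_plus_intro) auto
    then show "c \<in> \<Union>(range G)" by auto
  qed
  ultimately obtain \<F> where \<F>: "\<F> \<subseteq> range G" "finite \<F>" "C \<subseteq> \<Union>\<F>"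
    using C unfolding weakly_K_compact_def by blast
  obtain N where N: "finite N" "\<F> = G ` N"
    using finite_subset_image[OF \<F>(2,1)] by blast
  show ?thesis
  proof (rule bdd_belowI2)
    fix c assume "c \<in> C"
    then obtain n where n: "n \<in> N" "c \<in> G n"
      using \<F>(3) N(2) by auto
    then obtain u k where "c = u + k" "- real n < f u" "k \<in> K"
      unfolding G_def by (auto elim: set_plus_elim)
    then have "- real n \<le> f c"
      using nonneg[of k] linear_add[OF bounded_linear.linear[OF f], of u k] by simp
    moreover have "n \<le> Max N"
      using n N(1) by simp
    ultimately show "- real (Max N) \<le> f c" by simp
  qed
qed

text \<open>Otherwise \<open>f\<close> would tend to minus infinity along the ray from
  \<open>b\<close> in direction \<open>k\<close>.\<close>

lemma nonneg_on_cone_if_bdd_below_on_translate: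
  fixes f :: "'a::real_vector \<Rightarrow> real"
  assumes f: "linear f" and K: "cone K" and below: "\<And>k. k \<in> K \<Longrightarrow> m \<le> f (b + k)" and "k \<in> K"
  shows "0 \<le> f k"
proof (rule ccontr)
  assume "\<not> 0 \<le> f k"
  then have neg: "f k < 0" by simp
  obtain n where "f b - m < real n * (- f k)"
    using reals_Archimedean3[of "- f k"] neg by auto
  moreover have "m \<le> f (b + real n *\<^sub>R k)"
    using mem_cone[OF K \<open>k \<in> K\<close>] by (intro below) simp
  ultimately show False
    by (simp add: linear_add[OF f] linear_scale[OF f])
qed

section \<open>Distances to Minkowski sums\<close>

lemma infdist_greatest:
  assumes "S \<noteq> {}" "\<And>x. x \<in> S \<Longrightarrow> m \<le> dist a x"
  shows "m \<le> infdist a S"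
  using assms by (auto simp: infdist_notempty intro: cINF_greatest)

text \<open>Convexity is available only for \<open>closure B + K\<close>; this shows that passing to
  it from \<open>B + K\<close> loses no distance. Moving \<open>k\<close> to the side of
  \<open>a\<close> leaves the distance to \<open>B\<close>, which is 1-Lipschitz and vanishes at
  \<open>b\<close>.\<close>

lemma infdist_le_dist_closure_plus:
  fixes a :: "'a::real_normed_vector"
  assumes "x \<in> closure B + K"
  shows "infdist a (B + K) \<le> dist a x"
proof -
  obtain b k where x: "x = b + k" "b \<in> closure B" "k \<in> K"
    using assms by (rule set_plus_elim)
  then have "B \<noteq> {}" by auto
  have "infdist a (B + K) \<le> infdist (a - k) B"
  proof (rule infdist_greatest[OF \<open>B \<noteq> {}\<close>])
    fix y assume "y \<in> B"
    then have "infdist a (B + K) \<le> dist a (y + k)"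
      using x by (intro infdist_le set_plus_intro)
    then show "infdist a (B + K) \<le> dist (a - k) y"
      by (simp add: dist_norm algebra_simps)
  qed
  also have "\<dots> \<le> infdist b B + dist (a - k) b"
    by (rule infdist_triangle)
  also have "infdist b B = 0"
    using x(2) \<open>B \<noteq> {}\<close> by (simp add: in_closure_iff_infdist_zero)
  finally show ?thesis
    by (simp add: x(1) dist_norm algebra_simps)
qed

lemma infdist_plus_le:
  fixes a :: "'a::real_normed_vector"
  assumes "S \<noteq> {}" "c \<in> C"
  shows "infdist (a + c) (S + C) \<le> infdist a S"
proof (rule infdist_greatest[OF \<open>S \<noteq> {}\<close>])
  fix x assume "x \<in> S"
  then have "infdist (a + c) (S + C) \<le> dist (a + c) (x + c)"
    using assms by (intro infdist_le set_plus_intro)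
  then show "infdist (a + c) (S + C) \<le> dist a x" by simp
qed

text \<open>The cancellation step for a single point. On \<open>x = y + c'\<close> the functional
  gives \<open>f (x - (a + c)) = (f y - f a) + (f c' - f c)\<close>, where the first bracket is at
  least \<open>\<delta>\<close> and the second at least \<open>- \<epsilon>\<close>.\<close>

lemma infdist_le_infdist_plus:
  fixes K B C :: "'a::real_normed_vector set"
  assumes K: "cone K" "0 \<in> K" and "B \<noteq> {}"
    and C: "weakly_K_compact K C" and B: "K_convex K (closure B)" and "\<epsilon> > 0"
  obtains c where "c \<in> C" "infdist a (B + K) \<le> infdist (a + c) (B + K + C) + \<epsilon>"
proof -
  define \<delta> where "\<delta> = infdist a (B + K)"
  have "C \<noteq> {}"
    using C by (simp add: weakly_K_compact_def)
  obtain b where b: "b \<in> B" using \<open>B \<noteq> {}\<close> by blast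
  have sub: "B + K \<subseteq> closure B + K"
    by (intro set_plus_mono2 closure_subset order_refl)
  have "b + 0 \<in> B + K"
    using b K(2) by (rule set_plus_intro)
  then have BK: "B + K \<noteq> {}" by blast
  obtain f where f: "bounded_linear f" "\<And>x. f x \<le> norm x"
      "\<And>x. x \<in> closure B + K \<Longrightarrow> f a + \<delta> \<le> f x"
  proof (rule convex_separate_point[of "closure B + K" \<delta> a])
    show "convex (closure B + K)"
      using B by (simp add: K_convex_def)
    show "closure B + K \<noteq> {}" using BK sub by blast
    show "\<delta> \<ge> 0" by (simp add: \<delta>_def infdist_nonneg)
  qed (use infdist_le_dist_closure_plus \<delta>_def in auto)
  have lin: "linear f" using f(1) by (rule bounded_linear.linear)
  \<comment> \<open>The separation bounds \<open>f\<close> from below on the translate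
    \<open>b + K\<close>.\<close>
  have "0 \<le> f k" if "k \<in> K" for k
  proof (rule nonneg_on_cone_if_bdd_below_on_translate[OF lin K(1) _ that])
    show "f a + \<delta> \<le> f (b + k)" if "k \<in> K" for k
      using that b sub by (intro f(3)) auto
  qed
  then have bdd: "bdd_below (f ` C)"
    by (rule weakly_K_compact_bdd_below[OF C f(1) K(2)])
  \<comment> \<open>The infimum of \<open>f\<close> on \<open>C\<close> need not be attained, hence
    the slack \<open>\<epsilon>\<close>.\<close>
  obtain c where c: "c \<in> C" "f c < (INF c\<in>C. f c) + \<epsilon>"
    using cINF_less_iff[OF \<open>C \<noteq> {}\<close> bdd, of "(INF c\<in>C. f c) + \<epsilon>"] \<open>\<epsilon> > 0\<close> by auto
  have "\<delta> - \<epsilon> \<le> infdist (a + c) (B + K + C)"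
  proof (rule infdist_greatest)
    show "B + K + C \<noteq> {}"
      using BK \<open>C \<noteq> {}\<close> by (auto simp: set_plus_def)
    fix x assume "x \<in> B + K + C"
    then obtain y c' where x: "x = y + c'" "y \<in> B + K" "c' \<in> C"
      by (rule set_plus_elim)
    have "f c \<le> f c' + \<epsilon>"
      using c(2) cINF_lower[OF bdd x(3)] by simp
    moreover have "f a + \<delta> \<le> f y"
      using x(2) sub by (intro f(3)) blast
    moreover have "f (x - (a + c)) = f y + f c' - f a - f c"
      by (simp add: x(1) linear_diff[OF lin] linear_add[OF lin])
    moreover have "f (x - (a + c)) \<le> dist (a + c) x"
      using f(2)[of "x - (a + c)"] by (simp add: dist_norm norm_minus_commute)
    ultimately show "\<delta> - \<epsilon> \<le> dist (a + c) x" by simp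
  qed
  then show thesis
    using that[OF c(1)] by (simp add: \<delta>_def)
qed

theorem proposition3p2:
  fixes K A B C :: "'a::real_normed_vector set"
  assumes "closed K" and "convex K" and "cone K" and "pointed K"
    and "A \<noteq> {}" and "B \<noteq> {}" and "C \<noteq> {}"
    and "weakly_K_compact K C"
    and "K_convex K (closure B)"
  shows "excess A (B + K) = excess (A + C) (B + K + C)"
proof (rule antisym)
  have "0 \<in> K"
    using \<open>pointed K\<close> by (auto simp: pointed_def)
  show "excess A (B + K) \<le> excess (A + C) (B + K + C)"
    unfolding excess_def
  proof (rule SUP_least, rule ennreal_le_epsilon)
    fix a and \<epsilon> :: real
    assume "a \<in> A" "\<epsilon> > 0"
    obtain c where c: "c \<in> C" "infdist a (B + K) \<le> infdist (a + c) (B + K + C) + \<epsilon>"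
      using infdist_le_infdist_plus[OF \<open>cone K\<close> \<open>0 \<in> K\<close> \<open>B \<noteq> {}\<close> assms(8,9) \<open>\<epsilon> > 0\<close>] .
    have "ennreal (infdist a (B + K)) \<le> ennreal (infdist (a + c) (B + K + C)) + ennreal \<epsilon>"
      using c(2) \<open>\<epsilon> > 0\<close> by (simp add: infdist_nonneg ennreal_leI flip: ennreal_plus)
    also have "\<dots> \<le> (SUP x\<in>A + C. ennreal (infdist x (B + K + C))) + ennreal \<epsilon>"
      using \<open>a \<in> A\<close> c(1) by (intro add_right_mono SUP_upper set_plus_intro)
    finally show "ennreal (infdist a (B + K))
      \<le> (SUP x\<in>A + C. ennreal (infdist x (B + K + C))) + ennreal \<epsilon>" .
  qed
  show "excess (A + C) (B + K + C) \<le> excess A (B + K)"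
    unfolding excess_def
  proof (rule SUP_least)
    fix x assume "x \<in> A + C"
    then obtain a c where x: "x = a + c" "a \<in> A" "c \<in> C"
      by (rule set_plus_elim)
    have "B + K \<noteq> {}"
      using \<open>B \<noteq> {}\<close> \<open>0 \<in> K\<close> by (auto simp: set_plus_def)
    then have "ennreal (infdist x (B + K + C)) \<le> ennreal (infdist a (B + K))"
      unfolding x(1) by (intro ennreal_leI infdist_plus_le x(3))
    also have "\<dots> \<le> (SUP x\<in>A. ennreal (infdist x (B + K)))"
      using x(2) by (rule SUP_upper)
    finally show "ennreal (infdist x (B + K + C)) \<le> (SUP x\<in>A. ennreal (infdist x (B + K)))" .
  qed
qed

end
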